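(* Amongst all the $gl(2)$ Lie bialgebras with generators $\{D,H,C,M\}$, only the non-standard ones are Schrödinger Lie sub-bialgebras: a Lie bialgebra structure $\delta_{gl(2)}$ on the subalgebra $gl(2)=\mathrm{span}\{D,H,C,M\}$ of the Schrödinger algebra $\mathcal S$ is the restriction of some Lie bialgebra structure on $\mathcal S$ if and only if it is non-standard. The Schrödinger Lie bialgebras which contain non-standard $gl(2)$ Lie sub-bialgebras are the coboundary ones given by the following $r$-matrix and cocommutators, depending on seven real parameters $a_+,a_-,b_+,b_-,a,b,c_2$ which fulfil $$a_+b-b_+a=0,\quad a_+b_-+a_-b_+=0,\quad a_-b+b_-a=0,\quad a^2+a_+a_-=0:$$ $$r=\tfrac12\bigl(-a_+D\wedge H-a_-D\wedge C+b_+H\wedge M+b_-C\wedge M+bD\wedge M+2aH\wedge C+2c_2P\wedge K\bigr),$$ $\delta(D)=a_+D\wedge H-a_-D\wedge C-b_+H\wedge M+b_-C\wedge M$, $\delta(H)=-aD\wedge H+\tfrac12b_-D\wedge M-a_-H\wedge C+bH\wedge M$, $\delta(C)=-aD\wedge C-\tfrac12b_+D\wedge M-a_+H\wedge C-bC\wedge M$, $\delta(M)=0$, $\delta(P)=\tfrac12\bigl(a_+H\wedge P+a_-(C\wedge P+D\wedge K)-b_-K\wedge M+(b-2c_2)P\wedge M+2aK\wedge H\bigr)$, $\delta(K)=-\tfrac12\bigl(a_-C\wedge K+a_+(H\wedge K+D\wedge P)-b_+P\wedge M+(b+2c_2)K\wedge M-2aP\wedge C\bigr)$. The Schouten bracket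 is $[[r,r]]=-c_2^2\,K\wedge M\wedge P$.
   Context: $\mathcal S$ is the real 6-dimensional Lie algebra with basis $\{D,H,P,K,C,M\}$ and brackets $[D,P]=-P$, $[D,K]=K$, $[K,P]=M$, $[D,H]=-2H$, $[D,C]=2C$, $[H,C]=D$, $[K,H]=P$, $[K,C]=0$, $[P,C]=-K$, $[P,H]=0$, $[M,\cdot]=0$. The span of $D,H,C,M$ is a subalgebra isomorphic to $gl(2)$ (with $J_3=-D$, $J_+=H$, $J_-=-C$, $I=M$). A Lie bialgebra $(g,\delta)$ is a Lie algebra $g$ with a linear map $\delta:g\to g\otimes g$ which is a 1-cocycle, $\delta([X,Y])=[\delta(X),1\otimes Y+Y\otimes1]+[1\otimes X+X\otimes 1,\delta(Y)]$, and whose dual $\delta^*:g^*\otimes g^*\to g^*$ is a Lie bracket. It is coboundary with $r$-matrix $r$ (skew-symmetric in $g\otimes g$) if $\delta(X)=[1\otimes X+X\otimes1,r]$ for all $X$; it is then non-standard if $[[r,r]]=0$ and standard if $[[r,r]]\ne0$ is $\mathrm{ad}$-invariant, where $[[r,r]]=[r_{12},r_{13}]+[r_{12},r_{23}]+[r_{13},r_{23}]$ is the Schouten bracket. All Lie bialgebra structures on $gl(2)$ are coboundary; they come from $r=\frac12(a_+J_3\wedge J_+-a_-J_3\wedge J_--bJ_3\wedge I+b_+J_+\wedge I-b_-J_-\wedge I-2aJ_+\wedge J_-)$ with $a_+b-b_+a=0$, $a_+b_-+a_-b_+=0$, $a_-b+b_-a=0$, and $[[r,r]]=(a^2+a_+a_-)J_3\wedge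 J_+\wedge J_-$ for them. For Lie bialgebras $(h,\delta_h)$, $(g,\delta_g)$ with $h\subset g$ a Lie subalgebra, $h$ is a Lie sub-bialgebra of $g$ if $\delta_g(X)\in h\wedge h$ for all $X\in h$ (and $\delta_g|_h=\delta_h$). Convention: $X\wedge Y=X\otimes Y-Y\otimes X$, $X\wedge Y\wedge Z$ is the signed sum over all six permutations. *)

theory Defs
  imports "HOL-Analysis.Analysis"
begin

section \<open>Tensors over a real vector space with a chosen basis\<close>

text \<open>
  For \<open>g = real^'n\<close> the spaces \<open>g \<otimes> g\<close> and \<open>g \<otimes> g \<otimes> g\<close> are the coordinate spaces
  \<open>real^'n^'n\<close> and \<open>real^'n^'n^'n\<close>; the entry \<open>t $ i $ j\<close> is the coefficient of \<open>e\<^sub>i \<otimes> e\<^sub>j\<close>.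
\<close>

definition tensor :: "real^'n \<Rightarrow> real^'n \<Rightarrow> real^'n^'n"  (infixl "\<otimes>" 70) where
  "x \<otimes> y = (\<chi> i j. x $ i * y $ j)"

definition wedge :: "real^'n \<Rightarrow> real^'n \<Rightarrow> real^'n^'n"  (infixl "\<curlywedge>" 70) where
  "x \<curlywedge> y = x \<otimes> y - y \<otimes> x"

definition tensor3 :: "real^'n \<Rightarrow> real^'n \<Rightarrow> real^'n \<Rightarrow> real^'n^'n^'n" where
  "tensor3 x y z = (\<chi> i j k. x $ i * y $ j * z $ k)"

definition wedge3 :: "real^'n \<Rightarrow> real^'n \<Rightarrow> real^'n \<Rightarrow> real^'n^'n^'n" where
  "wedge3 x y z = tensor3 x y z + tensor3 y z x + tensor3 z x y
                - tensor3 y x z - tensor3 x z y - tensor3 z y x"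

text \<open>The linear map \<open>f \<otimes> g\<close> on the tensor square, for linear \<open>f\<close> and \<open>g\<close>.\<close>

definition tensor_map ::
  "(real^'m \<Rightarrow> real^'n) \<Rightarrow> (real^'m \<Rightarrow> real^'n) \<Rightarrow> real^'m^'m \<Rightarrow> real^'n^'n" where
  "tensor_map f g t = (\<Sum>i\<in>UNIV. \<Sum>j\<in>UNIV. (t $ i $ j) *\<^sub>R (f (axis i 1) \<otimes> g (axis j 1)))"

section \<open>Lie algebras and Lie bialgebras\<close>

definition lie_bracket :: "('a::real_vector \<Rightarrow> 'a \<Rightarrow> 'a) \<Rightarrow> bool" where
  "lie_bracket br \<longleftrightarrow>
     bilinear br \<and> (\<forall>x. br x x = 0) \<and>
     (\<forall>x y z. br x (br y z) + br y (br z x) + br z (br x y) = 0)"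

text \<open>\<open>ad_tensor br X t\<close> is \<open>[1 \<otimes> X + X \<otimes> 1, t]\<close>.\<close>

definition ad_tensor :: "(real^'n \<Rightarrow> real^'n \<Rightarrow> real^'n) \<Rightarrow> real^'n \<Rightarrow> real^'n^'n \<Rightarrow> real^'n^'n" where
  "ad_tensor br X t = tensor_map id (br X) t + tensor_map (br X) id t"

text \<open>
  The map \<open>\<delta>\<^sup>*\<close> on the dual: \<open>\<langle>\<delta>\<^sup>*(\<xi> \<otimes> \<eta>), X\<rangle> = \<langle>\<xi> \<otimes> \<eta>, \<delta> X\<rangle>\<close>.
  The abstraction below is a bounded linear functional as soon as \<open>\<delta>\<close> is linear.
\<close>

definition dual_bracket ::
  "(real^'n \<Rightarrow> real^'n^'n) \<Rightarrow> ((real^'n) \<Rightarrow>\<^sub>L real) \<Rightarrow> ((real^'n) \<Rightarrow>\<^sub>L real) \<Rightarrow> ((real^'n) \<Rightarrow>\<^sub>L real)" where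
  "dual_bracket \<delta> \<xi> \<eta> = Blinfun (\<lambda>X. \<Sum>i\<in>UNIV. \<Sum>j\<in>UNIV.
     \<delta> X $ i $ j * (blinfun_apply \<xi> (axis i 1) * blinfun_apply \<eta> (axis j 1)))"

text \<open>In the cocycle condition, \<open>[\<delta> X, 1 \<otimes> Y + Y \<otimes> 1] = - [1 \<otimes> Y + Y \<otimes> 1, \<delta> X]\<close>.\<close>

definition lie_bialgebra ::
  "(real^'n \<Rightarrow> real^'n \<Rightarrow> real^'n) \<Rightarrow> (real^'n \<Rightarrow> real^'n^'n) \<Rightarrow> bool" where
  "lie_bialgebra br \<delta> \<longleftrightarrow>
     lie_bracket br \<and>
     linear \<delta> \<and>
     (\<forall>X Y. \<delta> (br X Y) = - ad_tensor br Y (\<delta> X) + ad_tensor br X (\<delta> Y)) \<and>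
     lie_bracket (dual_bracket \<delta>)"

definition coboundary ::
  "(real^'n \<Rightarrow> real^'n \<Rightarrow> real^'n) \<Rightarrow> real^'n^'n \<Rightarrow> real^'n \<Rightarrow> real^'n^'n" where
  "coboundary br r X = ad_tensor br X r"

text \<open>The summands are \<open>[r\<^sub>1\<^sub>2, r\<^sub>1\<^sub>3]\<close>, \<open>[r\<^sub>1\<^sub>2, r\<^sub>2\<^sub>3]\<close> and \<open>[r\<^sub>1\<^sub>3, r\<^sub>2\<^sub>3]\<close> with
  \<open>r = \<Sum> r\<^sub>i\<^sub>j e\<^sub>i \<otimes> e\<^sub>j\<close> in the first and \<open>r = \<Sum> r\<^sub>k\<^sub>l e\<^sub>k \<otimes> e\<^sub>l\<close> in the second argument.\<close>

definition schouten :: "(real^'n \<Rightarrow> real^'n \<Rightarrow> real^'n) \<Rightarrow> real^'n^'n \<Rightarrow> real^'n^'n^'n" where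
  "schouten br r =
     (\<Sum>i\<in>UNIV. \<Sum>j\<in>UNIV. \<Sum>k\<in>UNIV. \<Sum>l\<in>UNIV. (r $ i $ j * r $ k $ l) *\<^sub>R
        (tensor3 (br (axis i 1) (axis k 1)) (axis j 1) (axis l 1)
       + tensor3 (axis i 1) (br (axis j 1) (axis k 1)) (axis l 1)
       + tensor3 (axis i 1) (axis k 1) (br (axis j 1) (axis l 1))))"

definition nonstandard ::
  "(real^'n \<Rightarrow> real^'n \<Rightarrow> real^'n) \<Rightarrow> (real^'n \<Rightarrow> real^'n^'n) \<Rightarrow> bool" where
  "nonstandard br \<delta> \<longleftrightarrow>
     (\<exists>r. transpose r = - r \<and> \<delta> = coboundary br r \<and> schouten br r = 0)"

text \<open>
  \<open>h\<close> is identified with a subalgebra of \<open>g\<close> along an injective homomorphism \<open>\<iota>\<close>. Since the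
  values of \<open>\<delta>\<^sub>h\<close> are skew-symmetric, the last conjunct says that \<open>\<delta>\<^sub>g\<close> maps \<open>h\<close> into
  the exterior square of \<open>h\<close> and restricts to \<open>\<delta>\<^sub>h\<close>.
\<close>

definition lie_sub_bialgebra ::
  "(real^'m \<Rightarrow> real^'n) \<Rightarrow>
   (real^'m \<Rightarrow> real^'m \<Rightarrow> real^'m) \<Rightarrow> (real^'m \<Rightarrow> real^'m^'m) \<Rightarrow>
   (real^'n \<Rightarrow> real^'n \<Rightarrow> real^'n) \<Rightarrow> (real^'n \<Rightarrow> real^'n^'n) \<Rightarrow> bool" where
  "lie_sub_bialgebra \<iota> br\<^sub>h \<delta>\<^sub>h br\<^sub>g \<delta>\<^sub>g \<longleftrightarrow>
     lie_bialgebra br\<^sub>h \<delta>\<^sub>h \<and> lie_bialgebra br\<^sub>g \<delta>\<^sub>g \<and>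
     linear \<iota> \<and> inj \<iota> \<and> (\<forall>X Y. \<iota> (br\<^sub>h X Y) = br\<^sub>g (\<iota> X) (\<iota> Y)) \<and>
     (\<forall>X. \<delta>\<^sub>g (\<iota> X) = tensor_map \<iota> \<iota> (\<delta>\<^sub>h X))"

section \<open>The Schroedinger algebra\<close>

datatype schr_index = gD | gH | gP | gK | gC | gM

lemma UNIV_schr_index: "UNIV = {gD, gH, gP, gK, gC, gM}"
proof -
  have "x \<in> {gD, gH, gP, gK, gC, gM}" for x by (cases x) auto
  then show ?thesis by blast
qed

instance schr_index :: finite
  by standard (simp add: UNIV_schr_index)

type_synonym schr = "real^schr_index"

abbreviation eD :: schr where "eD \<equiv> axis gD 1"
abbreviation eH :: schr where "eH \<equiv> axis gH 1"
abbreviation eP :: schr where "eP \<equiv> axis gP 1"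
abbreviation eK :: schr where "eK \<equiv> axis gK 1"
abbreviation eC :: schr where "eC \<equiv> axis gC 1"
abbreviation eM :: schr where "eM \<equiv> axis gM 1"

text \<open>Each nonzero bracket of basis elements occurs in one order only; \<open>schr_bracket\<close>
  is the antisymmetric bilinear extension.\<close>

fun schr_table :: "schr_index \<Rightarrow> schr_index \<Rightarrow> schr" where
  "schr_table gD gP = - eP"
| "schr_table gD gK = eK"
| "schr_table gK gP = eM"
| "schr_table gD gH = - 2 *\<^sub>R eH"
| "schr_table gD gC = 2 *\<^sub>R eC"
| "schr_table gH gC = eD"
| "schr_table gK gH = eP"
| "schr_table gP gC = - eK"
| "schr_table _ _ = 0"

definition schr_bracket :: "schr \<Rightarrow> schr \<Rightarrow> schr" where
  "schr_bracket x y =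
     (\<Sum>i\<in>UNIV. \<Sum>j\<in>UNIV. (x $ i * y $ j) *\<^sub>R (schr_table i j - schr_table j i))"

section \<open>The subalgebra gl(2) spanned by D, H, C, M\<close>

datatype gl2_index = hD | hH | hC | hM

lemma UNIV_gl2_index: "UNIV = {hD, hH, hC, hM}"
proof -
  have "x \<in> {hD, hH, hC, hM}" for x by (cases x) auto
  then show ?thesis by blast
qed

instance gl2_index :: finite
  by standard (simp add: UNIV_gl2_index)

type_synonym gl2 = "real^gl2_index"

primrec gl2_emb :: "gl2_index \<Rightarrow> schr_index" where
  "gl2_emb hD = gD"
| "gl2_emb hH = gH"
| "gl2_emb hC = gC"
| "gl2_emb hM = gM"

definition gl2_incl :: "gl2 \<Rightarrow> schr" where
  "gl2_incl x = (\<Sum>i\<in>UNIV. (x $ i) *\<^sub>R axis (gl2_emb i) 1)"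

text \<open>The Schroedinger bracket restricted to the span; no coordinate is lost, see
  \<open>gl2_incl_bracket\<close>.\<close>

definition gl2_bracket :: "gl2 \<Rightarrow> gl2 \<Rightarrow> gl2" where
  "gl2_bracket x y = (\<chi> i. schr_bracket (gl2_incl x) (gl2_incl y) $ gl2_emb i)"

lemma range_gl2_incl: "range gl2_incl = span {eD, eH, eC, eM}"
proof
  show "range gl2_incl \<subseteq> span {eD, eH, eC, eM}"
  proof clarify
    fix x
    have "gl2_incl x = x $ hD *\<^sub>R eD + x $ hH *\<^sub>R eH + x $ hC *\<^sub>R eC + x $ hM *\<^sub>R eM"
      by (simp add: gl2_incl_def UNIV_gl2_index)
    also have "\<dots> \<in> span {eD, eH, eC, eM}"
      by (intro span_add span_scale) (simp_all add: span_base)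
    finally show "gl2_incl x \<in> span {eD, eH, eC, eM}" .
  qed
  have lin: "linear gl2_incl"
    by (intro linearI) (simp_all add: gl2_incl_def UNIV_gl2_index algebra_simps)
  have "gl2_incl (axis i 1) = axis (gl2_emb i) 1" for i
    by (cases i) (simp_all add: gl2_incl_def UNIV_gl2_index axis_def)
  then have *: "axis (gl2_emb i) 1 \<in> range gl2_incl" for i
    by (metis rangeI)
  have "{eD, eH, eC, eM} \<subseteq> range gl2_incl"
    using *[of hD] *[of hH] *[of hC] *[of hM] by simp
  then show "span {eD, eH, eC, eM} \<subseteq> range gl2_incl"
    by (rule span_minimal) (simp add: lin linear_subspace_image)
qed

lemma gl2_incl_bracket: "gl2_incl (gl2_bracket x y) = schr_bracket (gl2_incl x) (gl2_incl y)"
proof -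
  have "gl2_incl (gl2_bracket x y) $ k = schr_bracket (gl2_incl x) (gl2_incl y) $ k" for k
    by (cases k) (simp_all add: gl2_incl_def gl2_bracket_def schr_bracket_def
      UNIV_gl2_index UNIV_schr_index axis_def)
  then show ?thesis by (simp add: vec_eq_iff)
qed

lemma lie_bracket_schr: "lie_bracket schr_bracket"
proof -
  have *: "schr_bracket x y $ k = (case k of
      gD \<Rightarrow> x $ gH * y $ gC - x $ gC * y $ gH
    | gH \<Rightarrow> - 2 * (x $ gD * y $ gH - x $ gH * y $ gD)
    | gP \<Rightarrow> - (x $ gD * y $ gP - x $ gP * y $ gD) + (x $ gK * y $ gH - x $ gH * y $ gK)
    | gK \<Rightarrow> (x $ gD * y $ gK - x $ gK * y $ gD) - (x $ gP * y $ gC - x $ gC * y $ gP)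
    | gC \<Rightarrow> 2 * (x $ gD * y $ gC - x $ gC * y $ gD)
    | gM \<Rightarrow> x $ gK * y $ gP - x $ gP * y $ gK)" for x y k
    by (cases k) (simp_all add: schr_bracket_def UNIV_schr_index axis_def)
  show ?thesis
    unfolding lie_bracket_def bilinear_def
    by (auto simp: vec_eq_iff * algebra_simps intro!: linearI split: schr_index.split)
qed

section \<open>The family of r-matrices\<close>

definition schr_r :: "real \<Rightarrow> real \<Rightarrow> real \<Rightarrow> real \<Rightarrow> real \<Rightarrow> real \<Rightarrow> real \<Rightarrow> real^schr_index^schr_index" where
  "schr_r ap am bp bm a b c2 = (1/2) *\<^sub>R
     (- ap *\<^sub>R (eD \<curlywedge> eH) - am *\<^sub>R (eD \<curlywedge> eC) + bp *\<^sub>R (eH \<curlywedge> eM) + bm *\<^sub>R (eC \<curlywedge> eM)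
      + b *\<^sub>R (eD \<curlywedge> eM) + (2 * a) *\<^sub>R (eH \<curlywedge> eC) + (2 * c2) *\<^sub>R (eP \<curlywedge> eK))"

text \<open>The arguments are \<open>a\<^sub>+, a\<^sub>-, b\<^sub>+, b\<^sub>-, a, b\<close>.\<close>

definition schr_params :: "real \<Rightarrow> real \<Rightarrow> real \<Rightarrow> real \<Rightarrow> real \<Rightarrow> real \<Rightarrow> bool" where
  "schr_params ap am bp bm a b \<longleftrightarrow>
     ap * b - bp * a = 0 \<and> ap * bm + am * bp = 0 \<and> am * b + bm * a = 0 \<and> a\<^sup>2 + ap * am = 0"

end

theory Submission
  imports Defs
begin

text \<open>
  Skew-symmetry of \<open>\<delta>\<close> and the inclusion of \<open>\<delta>(gl(2))\<close> in the exterior square of \<open>gl(2)\<close> leave 54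
  unknown structure constants. On these the cocycle identity is a linear system; its solution
  space is seven-dimensional and consists of the coboundaries of \<open>schr_r\<close>. The co-Jacobi identity
  for such a coboundary is equivalent to the four quadratic relations. Three of them already express
  that the restriction is a Lie bialgebra structure on \<open>gl(2)\<close>. The fourth, \<open>a\<^sup>2 + a\<^sub>+ a\<^sub>- = 0\<close>, comes
  only from \<open>\<delta>(P)\<close> and \<open>\<delta>(K)\<close>; since \<open>a\<^sup>2 + a\<^sub>+ a\<^sub>-\<close> is the remaining coefficient of the \<open>gl(2)\<close>
  Schouten bracket, this is what forces the restriction to be non-standard.
\<close>

section \<open>Tensors in coordinates\<close>

lemma linear_expand:
  fixes f :: "real^'n \<Rightarrow> 'a::real_vector"
  assumes "linear f"
  shows "f v = (\<Sum>i\<in>UNIV. v $ i *\<^sub>R f (axis i 1))"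
proof -
  have "f v = f (\<Sum>i\<in>UNIV. v $ i *\<^sub>R axis i 1)"
    using basis_expansion[of v] by (simp add: scalar_mult_eq_scaleR)
  then show ?thesis
    by (simp add: linear_sum[OF assms] linear_scale[OF assms])
qed

lemma axis_nth: "axis i c $ j = (if j = i then c else 0)"
  by (simp add: axis_def)

lemma wedge_nth: "(x \<curlywedge> y) $ i $ j = x $ i * y $ j - y $ i * x $ j"
  by (simp add: wedge_def tensor_def)

lemma wedge3_nth:
  "wedge3 x y z $ i $ j $ k
     = x $ i * y $ j * z $ k + y $ i * z $ j * x $ k + z $ i * x $ j * y $ k
     - y $ i * x $ j * z $ k - x $ i * z $ j * y $ k - z $ i * y $ j * x $ k"
  by (simp add: wedge3_def tensor3_def)

lemma tensor_map_nth:
  "tensor_map f g t $ a $ b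
     = (\<Sum>i\<in>UNIV. \<Sum>j\<in>UNIV. t $ i $ j * (f (axis i 1) $ a * g (axis j 1) $ b))"
  by (simp add: tensor_map_def tensor_def)

lemma linear_tensor_map: "linear (tensor_map f g)"
  by (intro linearI)
    (simp_all add: vec_eq_iff tensor_map_nth algebra_simps sum.distrib sum_distrib_left)

lemma tensor_map_compose:
  assumes "linear f" "linear g"
  shows "tensor_map f g (tensor_map f' g' t) = tensor_map (\<lambda>x. f (f' x)) (\<lambda>x. g (g' x)) t"
proof -
  have tensor: "tensor_map f g (x \<otimes> y) = f x \<otimes> g y" for x y
    using linear_expand[OF assms(1), of x] linear_expand[OF assms(2), of y]
    by (simp add: vec_eq_iff tensor_map_nth tensor_def sum_product mult_ac)
  have "tensor_map f g (tensor_map f' g' t)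
      = (\<Sum>i\<in>UNIV. \<Sum>j\<in>UNIV. t $ i $ j *\<^sub>R tensor_map f g (f' (axis i 1) \<otimes> g' (axis j 1)))"
    unfolding tensor_map_def[of f' g']
    by (simp add: linear_sum[OF linear_tensor_map] linear_scale[OF linear_tensor_map])
  then show ?thesis
    by (simp only: tensor tensor_map_def[of "\<lambda>x. f (f' x)"])
qed

text \<open>Fixing one leg of a tensor leaves a row or a column, and \<open>f\<close> acts on that
  vector. Later computations can therefore apply brackets to rows and columns instead of summing
  over pairs of basis elements.\<close>

lemma tensor_map_id_nth:
  assumes "linear f"
  shows "tensor_map id f t $ i $ j = f (row i t) $ j"
    and "tensor_map f id t $ i $ j = f (column j t) $ i"
proof -
  have "f (row i t) $ j = (\<Sum>l\<in>UNIV. t $ i $ l * f (axis l 1) $ j)"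
    using linear_expand[OF assms, of "row i t"] by (simp add: row_def)
  then show "tensor_map id f t $ i $ j = f (row i t) $ j"
    by (simp add: tensor_map_nth axis_def if_distrib[of "\<lambda>x. x * _"]
        if_distrib[of "\<lambda>x. _ * x"] flip: sum_distrib_right cong: if_cong)
      (subst sum.swap, simp add: sum.delta)
  have "f (column j t) $ i = (\<Sum>l\<in>UNIV. t $ l $ j * f (axis l 1) $ i)"
    using linear_expand[OF assms, of "column j t"] by (simp add: column_def)
  then show "tensor_map f id t $ i $ j = f (column j t) $ i"
    by (simp add: tensor_map_nth axis_def if_distrib[of "\<lambda>x. x * _"]
        if_distrib[of "\<lambda>x. _ * x"] cong: if_cong)
qed

section \<open>Adjoint action on tensors, coboundaries and the Schouten bracket\<close>

lemma lie_bracketD: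
  assumes "lie_bracket br"
  shows "linear (br x)" "linear (\<lambda>x. br x y)" "br x y = - br y x"
    "br (br x y) z = br x (br y z) - br y (br x z)"
proof -
  have bil: "bilinear br" and alt: "\<And>x. br x x = 0"
    and jac: "\<And>x y z. br x (br y z) + br y (br z x) + br z (br x y) = 0"
    using assms by (auto simp: lie_bracket_def)
  show lin: "linear (br x)" "linear (\<lambda>x. br x y)" for x y
    using bil by (auto simp: bilinear_def)
  show skew: "br x y = - br y x" for x y
    using alt[of "x + y"] alt[of x] alt[of y]
    by (simp add: bilinear_ladd[OF bil] bilinear_radd[OF bil] eq_neg_iff_add_eq_0 add.commute)
  have "br z x = - br x z" "br (br x y) z = - br z (br x y)"
    by (rule skew)+
  then show "br (br x y) z = br x (br y z) - br y (br x z)"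
    using jac[of x y z] by (simp add: linear_neg[OF lin(1)] algebra_simps)
qed

lemma ad_tensor_nth:
  assumes "lie_bracket br"
  shows "ad_tensor br X t $ i $ j = br X (row i t) $ j + br X (column j t) $ i"
  by (simp add: ad_tensor_def tensor_map_id_nth lie_bracketD(1)[OF assms])

text \<open>The tensor square is a module: in \<open>ad_tensor br A (ad_tensor br B t)\<close> the
  mixed part, with \<open>br A\<close> on one leg and \<open>br B\<close> on the other, is symmetric
  in \<open>A\<close> and \<open>B\<close> and cancels in the commutator. The rest is the Jacobi
  identity on a single leg.\<close>

lemma ad_tensor_bracket:
  assumes "lie_bracket br"
  shows "ad_tensor br (br X Y) t = ad_tensor br X (ad_tensor br Y t) - ad_tensor br Y (ad_tensor br X t)"
proof -
  note lin = lie_bracketD(1)[OF assms] linear_id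
  have "tensor_map id (br (br X Y)) t
      = tensor_map id (\<lambda>x. br X (br Y x)) t - tensor_map id (\<lambda>x. br Y (br X x)) t"
    "tensor_map (br (br X Y)) id t
      = tensor_map (\<lambda>x. br X (br Y x)) id t - tensor_map (\<lambda>x. br Y (br X x)) id t"
    by (simp_all add: vec_eq_iff tensor_map_nth lie_bracketD(4)[OF assms] algebra_simps
        flip: sum_subtractf)
  moreover have "ad_tensor br A (ad_tensor br B t)
      = tensor_map id (\<lambda>x. br A (br B x)) t + tensor_map (br B) (br A) t
        + (tensor_map (br A) (br B) t + tensor_map (\<lambda>x. br A (br B x)) id t)" for A B
    by (simp add: ad_tensor_def linear_add[OF linear_tensor_map] tensor_map_compose[OF lin(2) lin(1)]
        tensor_map_compose[OF lin(1) lin(2)])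
      (simp add: id_def)
  ultimately show ?thesis
    by (simp add: ad_tensor_def)
qed

lemma coboundary_cocycle:
  assumes "lie_bracket br"
  shows "coboundary br r (br X Y)
    = - ad_tensor br Y (coboundary br r X) + ad_tensor br X (coboundary br r Y)"
  by (simp add: coboundary_def ad_tensor_bracket[OF assms])

lemma linear_coboundary:
  assumes "lie_bracket br"
  shows "linear (coboundary br r)"
  unfolding coboundary_def
  by (intro linearI)
    (simp_all add: vec_eq_iff ad_tensor_nth[OF assms] linear_add[OF lie_bracketD(2)[OF assms]]
      linear_scale[OF lie_bracketD(2)[OF assms]] algebra_simps)

text \<open>In each summand of the definition two legs are basis vectors, whose Kronecker deltas
  absorb two of the four sums. What remains is one bracket of rows or columns of
  \<open>r\<close>.\<close>

lemma schouten_nth: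
  assumes "lie_bracket br"
  shows "schouten br r $ x $ y $ z
    = br (column y r) (column z r) $ x + br (row x r) (column z r) $ y + br (row x r) (row y r) $ z"
proof -
  have expand: "br u v $ a = (\<Sum>i\<in>UNIV. \<Sum>k\<in>UNIV. u $ i * v $ k * br (axis i 1) (axis k 1) $ a)"
    for u v a
  proof -
    have "br u v = (\<Sum>i\<in>UNIV. u $ i *\<^sub>R br (axis i 1) v)"
      by (rule linear_expand[OF lie_bracketD(2)[OF assms]])
    moreover have "br (axis i 1) v = (\<Sum>k\<in>UNIV. v $ k *\<^sub>R br (axis i 1) (axis k 1))" for i
      by (rule linear_expand[OF lie_bracketD(1)[OF assms]])
    ultimately show ?thesis
      by (simp add: sum_distrib_left mult_ac)
  qed
  \<comment> \<open>Moves a delta out of the inner sums, so that it meets the sum over its own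
    index.\<close>
  have pull_if: "(\<Sum>k\<in>UNIV. if P then f k else 0) = (if P then \<Sum>k\<in>UNIV. f k else 0)"
    for P and f :: "'n \<Rightarrow> real"
    by simp
  have "br (column y r) (column z r) $ x
      = (\<Sum>i\<in>UNIV. \<Sum>k\<in>UNIV. r $ i $ y * r $ k $ z * br (axis i 1) (axis k 1) $ x)"
    "br (row x r) (column z r) $ y
      = (\<Sum>j\<in>UNIV. \<Sum>k\<in>UNIV. r $ x $ j * r $ k $ z * br (axis j 1) (axis k 1) $ y)"
    "br (row x r) (row y r) $ z
      = (\<Sum>j\<in>UNIV. \<Sum>l\<in>UNIV. r $ x $ j * r $ y $ l * br (axis j 1) (axis l 1) $ z)"
    by (subst expand, simp add: row_def column_def)+
  then show ?thesis
    by (simp add: schouten_def tensor3_def axis_nth distrib_left sum.distrib pull_if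
        if_distrib[of "\<lambda>x. x * _"] if_distrib[of "\<lambda>x. _ * x"] cong: if_cong)
qed

section \<open>The bracket on the dual space\<close>

lemma dual_bracket_apply:
  assumes "linear \<delta>"
  shows "blinfun_apply (dual_bracket \<delta> \<xi> \<eta>) X
    = (\<Sum>i\<in>UNIV. \<Sum>j\<in>UNIV. \<delta> X $ i $ j * (\<xi> (axis i 1) * \<eta> (axis j 1)))"
proof -
  have "linear (\<lambda>X. \<Sum>i\<in>UNIV. \<Sum>j\<in>UNIV. \<delta> X $ i $ j * (\<xi> (axis i 1) * \<eta> (axis j 1)))"
    by (intro linearI)
      (simp_all add: linear_add[OF assms] linear_scale[OF assms] algebra_simps sum.distrib
        sum_distrib_left)
  then show ?thesis
    by (simp add: dual_bracket_def bounded_linear_Blinfun_apply linear_conv_bounded_linear)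
qed

text \<open>The nested bracket evaluates \<open>(1 \<otimes> \<delta>) (\<delta> X)\<close> on three
  functionals: since the inner bracket is a linear functional, its values along the second leg of
  \<open>\<delta> X\<close> add up to its value at \<open>row i (\<delta> X)\<close>.\<close>

lemma dual_bracket_dual_bracket:
  assumes "linear \<delta>"
  shows "blinfun_apply (dual_bracket \<delta> \<xi> (dual_bracket \<delta> \<eta> \<zeta>)) X
    = (\<Sum>i\<in>UNIV. \<Sum>j\<in>UNIV. \<Sum>k\<in>UNIV. \<delta> (row i (\<delta> X)) $ j $ k
        * (\<xi> (axis i 1) * \<eta> (axis j 1) * \<zeta> (axis k 1)))"
proof -
  have "(\<Sum>l\<in>UNIV. \<delta> X $ i $ l * dual_bracket \<delta> \<eta> \<zeta> (axis l 1))
      = dual_bracket \<delta> \<eta> \<zeta> (row i (\<delta> X))" for i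
    using linear_expand[OF bounded_linear.linear[OF blinfun.bounded_linear_right],
        of "dual_bracket \<delta> \<eta> \<zeta>" "row i (\<delta> X)"]
    by (simp add: row_def)
  then have "dual_bracket \<delta> \<xi> (dual_bracket \<delta> \<eta> \<zeta>) X
      = (\<Sum>i\<in>UNIV. \<xi> (axis i 1) * dual_bracket \<delta> \<eta> \<zeta> (row i (\<delta> X)))"
    by (subst dual_bracket_apply[OF assms]) (simp add: mult.left_commute flip: sum_distrib_left)
  then show ?thesis
    by (simp add: dual_bracket_apply[OF assms] sum_distrib_left mult_ac)
qed

text \<open>The dual basis; on it the dual bracket returns single structure constants.\<close>

definition coordinate :: "'n \<Rightarrow> (real^'n) \<Rightarrow>\<^sub>L real" where
  "coordinate i = Blinfun (\<lambda>x. x $ i)"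

lemma coordinate_apply [simp]: "coordinate i x = x $ i"
  by (simp add: coordinate_def bounded_linear_Blinfun_apply bounded_linear_vec_nth)

text \<open>
  The entries of \<open>(1 \<otimes> \<delta>) (\<delta> X)\<close> are \<open>\<Sum>\<^sub>l \<delta> X $ i $ l * \<delta> e\<^sub>l $ j $ k = \<delta> (row i (\<delta> X)) $ j $ k\<close>, so the
  second conjunct below is the co-Jacobi identity.
\<close>

lemma lie_bracket_dual_bracket_iff:
  assumes "linear \<delta>"
  shows "lie_bracket (dual_bracket \<delta>) \<longleftrightarrow>
    (\<forall>X i j. \<delta> X $ i $ j = - \<delta> X $ j $ i) \<and>
    (\<forall>X i j k. \<delta> (row i (\<delta> X)) $ j $ k + \<delta> (row j (\<delta> X)) $ k $ i
             + \<delta> (row k (\<delta> X)) $ i $ j = 0)" (is "?L \<longleftrightarrow> ?skew \<and> ?jac")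
proof
  assume L: ?L
  have *: "dual_bracket \<delta> (coordinate i) (coordinate j) X = \<delta> X $ i $ j" for i j X
    by (simp add: dual_bracket_apply[OF assms] axis_def if_distrib[of "\<lambda>x. x * _"]
        if_distrib[of "\<lambda>x. _ * x"] cong: if_cong)
  have **: "dual_bracket \<delta> (coordinate i) (dual_bracket \<delta> (coordinate j) (coordinate k)) X
      = \<delta> (row i (\<delta> X)) $ j $ k" for i j k X
    by (simp add: dual_bracket_dual_bracket[OF assms] axis_def if_distrib[of "\<lambda>x. x * _"]
        if_distrib[of "\<lambda>x. _ * x"] cong: if_cong)
  have ?skew
  proof (intro allI)
    fix X i j
    show "\<delta> X $ i $ j = - \<delta> X $ j $ i"
      using lie_bracketD(3)[OF L, of "coordinate i" "coordinate j"]
      by (simp add: uminus_blinfun.rep_eq flip: *)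
  qed
  moreover have ?jac
  proof (intro allI)
    fix X i j k
    have "dual_bracket \<delta> (coordinate i) (dual_bracket \<delta> (coordinate j) (coordinate k))
        + dual_bracket \<delta> (coordinate j) (dual_bracket \<delta> (coordinate k) (coordinate i))
        + dual_bracket \<delta> (coordinate k) (dual_bracket \<delta> (coordinate i) (coordinate j)) = 0"
      using L by (simp add: lie_bracket_def)
    from arg_cong[OF this, of "\<lambda>f. f X"]
    show "\<delta> (row i (\<delta> X)) $ j $ k + \<delta> (row j (\<delta> X)) $ k $ i + \<delta> (row k (\<delta> X)) $ i $ j = 0"
      by (simp add: ** plus_blinfun.rep_eq)
  qed
  ultimately show "?skew \<and> ?jac" ..
next
  assume R: "?skew \<and> ?jac"
  show ?L
    unfolding lie_bracket_def bilinear_def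
  proof (intro conjI allI)
    show "linear (dual_bracket \<delta> \<xi>)" for \<xi>
      by (intro linearI blinfun_eqI)
        (simp_all add: dual_bracket_apply[OF assms] plus_blinfun.rep_eq scaleR_blinfun.rep_eq
          algebra_simps sum.distrib sum_distrib_left)
    show "linear (\<lambda>\<xi>. dual_bracket \<delta> \<xi> \<eta>)" for \<eta>
      by (intro linearI blinfun_eqI)
        (simp_all add: dual_bracket_apply[OF assms] plus_blinfun.rep_eq scaleR_blinfun.rep_eq
          algebra_simps sum.distrib sum_distrib_left)
    show "dual_bracket \<delta> \<xi> \<xi> = 0" for \<xi>
    proof (rule blinfun_eqI)
      fix X
      let ?s = "\<lambda>i j. \<delta> X $ i $ j * (\<xi> (axis i 1) * \<xi> (axis j 1))"
      \<comment> \<open>Exchanging the indices turns the sum into its own negative.\<close>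
      have "(\<Sum>i\<in>UNIV. \<Sum>j\<in>UNIV. ?s i j) = (\<Sum>i\<in>UNIV. \<Sum>j\<in>UNIV. ?s j i)"
        by (rule sum.swap)
      also have "\<dots> = (\<Sum>i\<in>UNIV. \<Sum>j\<in>UNIV. - ?s i j)"
      proof (intro sum.cong refl)
        show "?s j i = - ?s i j" for i j
          using R[THEN conjunct1, rule_format, of X j i] by simp
      qed
      finally show "dual_bracket \<delta> \<xi> \<xi> X = blinfun_apply 0 X"
        by (simp add: dual_bracket_apply[OF assms] sum_negf)
    qed
    show "dual_bracket \<delta> \<xi> (dual_bracket \<delta> \<eta> \<zeta>) + dual_bracket \<delta> \<eta> (dual_bracket \<delta> \<zeta> \<xi>)
      + dual_bracket \<delta> \<zeta> (dual_bracket \<delta> \<xi> \<eta>) = 0" for \<xi> \<eta> \<zeta>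
    proof (rule blinfun_eqI)
      fix X
      let ?T = "\<lambda>i j k. \<delta> (row i (\<delta> X)) $ j $ k"
      let ?m = "\<lambda>i j k. \<xi> (axis i 1) * \<eta> (axis j 1) * \<zeta> (axis k 1)"
      \<comment> \<open>The cyclic terms are reindexed to share the factor \<open>?m i j k\<close>,
        whose coefficient is then the co-Jacobi sum.\<close>
      have 2: "dual_bracket \<delta> \<eta> (dual_bracket \<delta> \<zeta> \<xi>) X
          = (\<Sum>i\<in>UNIV. \<Sum>j\<in>UNIV. \<Sum>k\<in>UNIV. ?T j k i * ?m i j k)"
        unfolding dual_bracket_dual_bracket[OF assms]
        by (subst sum.swap, rule sum.cong[OF refl], subst sum.swap) (simp add: mult_ac)
      have 3: "dual_bracket \<delta> \<zeta> (dual_bracket \<delta> \<xi> \<eta>) X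
          = (\<Sum>i\<in>UNIV. \<Sum>j\<in>UNIV. \<Sum>k\<in>UNIV. ?T k i j * ?m i j k)"
        unfolding dual_bracket_dual_bracket[OF assms]
        by (subst sum.swap, rule sum.cong[OF refl], subst sum.swap) (simp add: mult_ac)
      have "(?T i j k + ?T j k i + ?T k i j) * ?m i j k = 0" for i j k
        using R[THEN conjunct2, rule_format, of i X j k] by simp
      then have "(\<Sum>i\<in>UNIV. \<Sum>j\<in>UNIV. \<Sum>k\<in>UNIV. (?T i j k + ?T j k i + ?T k i j) * ?m i j k) = 0"
        by (simp only: sum.neutral_const)
      then show "(dual_bracket \<delta> \<xi> (dual_bracket \<delta> \<eta> \<zeta>) + dual_bracket \<delta> \<eta> (dual_bracket \<delta> \<zeta> \<xi>)
          + dual_bracket \<delta> \<zeta> (dual_bracket \<delta> \<xi> \<eta>)) X = blinfun_apply 0 X"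
        by (simp add: plus_blinfun.rep_eq 2 3 dual_bracket_dual_bracket[OF assms, of \<xi> \<eta> \<zeta>]
            distrib_right sum.distrib)
    qed
  qed
qed

text \<open>Testing co-Jacobi on basis vectors suffices because the cyclic sum is linear in
  \<open>X\<close>. Skewness of \<open>r\<close> passes to the coboundary, and the cocycle identity
  is \<open>coboundary_cocycle\<close>.\<close>

lemma lie_bialgebra_coboundaryI:
  assumes br: "lie_bracket br" and r: "transpose r = - r"
    and jac: "\<And>l i j k. coboundary br r (row i (coboundary br r (axis l 1))) $ j $ k
        + coboundary br r (row j (coboundary br r (axis l 1))) $ k $ i
        + coboundary br r (row k (coboundary br r (axis l 1))) $ i $ j = 0"
  shows "lie_bialgebra br (coboundary br r)"
proof -
  let ?\<delta> = "coboundary br r"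
  note lin = linear_coboundary[OF br, of r]
  have "row i (- r) = - row i r" for i
    by (simp add: vec_eq_iff row_def)
  then have "column i r = - row i r" for i
    using r by (metis row_transpose)
  then have skew: "?\<delta> X $ i $ j = - ?\<delta> X $ j $ i" for X i j
    by (simp add: coboundary_def ad_tensor_nth[OF br] linear_neg[OF lie_bracketD(1)[OF br]])
  have "?\<delta> (row i (?\<delta> X)) $ j $ k + ?\<delta> (row j (?\<delta> X)) $ k $ i + ?\<delta> (row k (?\<delta> X)) $ i $ j = 0"
    (is "?J X = 0") for X i j k
  proof -
    have "row i (A + B) = row i A + row i B" "row i (c *\<^sub>R A) = c *\<^sub>R row i A"
      for i c and A B :: "real^'a^'a"
      by (simp_all add: vec_eq_iff row_def)
    then have "linear ?J"
      by (intro linearI)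
        (simp_all add: linear_add[OF lin] linear_scale[OF lin] algebra_simps)
    then show ?thesis
      by (subst linear_expand) (simp_all add: jac)
  qed
  then show ?thesis
    unfolding lie_bialgebra_def lie_bracket_dual_bracket_iff[OF lin]
    using skew lin br coboundary_cocycle[OF br] by blast
qed

section \<open>The Schroedinger algebra and gl(2) in coordinates\<close>

lemma all_schr_index: "(\<forall>i. P i) \<longleftrightarrow> P gD \<and> P gH \<and> P gP \<and> P gK \<and> P gC \<and> P gM"
  by (metis schr_index.exhaust)

lemma all_gl2_index: "(\<forall>i. P i) \<longleftrightarrow> P hD \<and> P hH \<and> P hC \<and> P hM"
  by (metis gl2_index.exhaust)

lemma schr_bracket_nth:
  "schr_bracket x y $ gD = x $ gH * y $ gC - x $ gC * y $ gH"
  "schr_bracket x y $ gH = - 2 * (x $ gD * y $ gH - x $ gH * y $ gD)"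
  "schr_bracket x y $ gP = - (x $ gD * y $ gP - x $ gP * y $ gD) + (x $ gK * y $ gH - x $ gH * y $ gK)"
  "schr_bracket x y $ gK = (x $ gD * y $ gK - x $ gK * y $ gD) - (x $ gP * y $ gC - x $ gC * y $ gP)"
  "schr_bracket x y $ gC = 2 * (x $ gD * y $ gC - x $ gC * y $ gD)"
  "schr_bracket x y $ gM = x $ gK * y $ gP - x $ gP * y $ gK"
  by (simp_all add: schr_bracket_def UNIV_schr_index axis_def)

lemma gl2_incl_nth [simp]:
  "gl2_incl x $ gl2_emb i = x $ i" "gl2_incl x $ gP = 0" "gl2_incl x $ gK = 0"
  "gl2_incl x $ gD = x $ hD" "gl2_incl x $ gH = x $ hH" "gl2_incl x $ gC = x $ hC" "gl2_incl x $ gM = x $ hM"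
  by (cases i; simp add: gl2_incl_def UNIV_gl2_index axis_def)
    (simp_all add: gl2_incl_def UNIV_gl2_index axis_def)

lemma gl2_bracket_nth:
  "gl2_bracket x y $ hD = x $ hH * y $ hC - x $ hC * y $ hH"
  "gl2_bracket x y $ hH = - 2 * (x $ hD * y $ hH - x $ hH * y $ hD)"
  "gl2_bracket x y $ hC = 2 * (x $ hD * y $ hC - x $ hC * y $ hD)"
  "gl2_bracket x y $ hM = 0"
  by (simp_all add: gl2_bracket_def schr_bracket_nth)

lemma lie_bracket_gl2: "lie_bracket gl2_bracket"
  unfolding lie_bracket_def bilinear_def
  by (auto simp: vec_eq_iff all_gl2_index gl2_bracket_nth algebra_simps intro!: linearI)

lemma linear_gl2_incl: "linear gl2_incl"
  by (intro linearI) (simp_all add: vec_eq_iff all_schr_index)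

lemma inj_gl2_incl: "inj gl2_incl"
  by (intro injI) (simp add: vec_eq_iff all_schr_index all_gl2_index)

lemma gl2_incl_axis: "gl2_incl (axis i 1) = axis (gl2_emb i) 1"
  by (cases i) (simp_all add: vec_eq_iff all_schr_index axis_nth)

lemma schr_bracket_axis:
  "schr_bracket (axis i 1) (axis j 1) = schr_table i j - schr_table j i"
  by (cases i; cases j; simp add: vec_eq_iff all_schr_index schr_bracket_nth axis_nth)

text \<open>The general gl(2) r-matrix, written in D, H, C, M instead of the J basis. The final 0
  fills the slot of \<open>c2\<close>, whose term \<open>eP \<curlywedge> eK\<close> lies outside
  the gl(2) block.\<close>

definition gl2_r :: "real \<Rightarrow> real \<Rightarrow> real \<Rightarrow> real \<Rightarrow> real \<Rightarrow> real \<Rightarrow> real^gl2_index^gl2_index" where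
  "gl2_r ap am bp bm a b = (\<chi> i j. schr_r ap am bp bm a b 0 $ gl2_emb i $ gl2_emb j)"

lemma coboundary_schr_nth:
  "coboundary schr_bracket r X $ i $ j = schr_bracket X (row i r) $ j + schr_bracket X (column j r) $ i"
  by (simp add: coboundary_def ad_tensor_nth[OF lie_bracket_schr])

lemma coboundary_gl2_nth:
  "coboundary gl2_bracket r X $ i $ j = gl2_bracket X (row i r) $ j + gl2_bracket X (column j r) $ i"
  by (simp add: coboundary_def ad_tensor_nth[OF lie_bracket_gl2])

lemma schr_r_nth:
  "schr_r ap am bp bm a b c2 $ i = (case i of
     gD \<Rightarrow> (1/2) *\<^sub>R (- ap *\<^sub>R eH - am *\<^sub>R eC + b *\<^sub>R eM)
   | gH \<Rightarrow> (1/2) *\<^sub>R (ap *\<^sub>R eD + bp *\<^sub>R eM + (2 * a) *\<^sub>R eC)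
   | gP \<Rightarrow> c2 *\<^sub>R eK
   | gK \<Rightarrow> - c2 *\<^sub>R eP
   | gC \<Rightarrow> (1/2) *\<^sub>R (am *\<^sub>R eD + bm *\<^sub>R eM - (2 * a) *\<^sub>R eH)
   | gM \<Rightarrow> (1/2) *\<^sub>R (- bp *\<^sub>R eH - bm *\<^sub>R eC - b *\<^sub>R eD))"
  by (cases i)
    (simp_all add: vec_eq_iff all_schr_index schr_r_def wedge_nth axis_nth)

section \<open>Cocommutators, Schouten bracket and co-Jacobi identity of the family\<close>

lemma coboundary_schr_r_axis:
  fixes ap am bp bm a b c2 :: real
  defines "\<delta> \<equiv> coboundary schr_bracket (schr_r ap am bp bm a b c2)"
  shows
    "\<delta> eD = ap *\<^sub>R (eD \<curlywedge> eH) - am *\<^sub>R (eD \<curlywedge> eC) - bp *\<^sub>R (eH \<curlywedge> eM) + bm *\<^sub>R (eC \<curlywedge> eM)"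
    "\<delta> eH = - a *\<^sub>R (eD \<curlywedge> eH) + (1/2 * bm) *\<^sub>R (eD \<curlywedge> eM) - am *\<^sub>R (eH \<curlywedge> eC)
                 + b *\<^sub>R (eH \<curlywedge> eM)"
    "\<delta> eC = - a *\<^sub>R (eD \<curlywedge> eC) - (1/2 * bp) *\<^sub>R (eD \<curlywedge> eM) - ap *\<^sub>R (eH \<curlywedge> eC)
                 - b *\<^sub>R (eC \<curlywedge> eM)"
    "\<delta> eM = 0"
    "\<delta> eP = (1/2) *\<^sub>R (ap *\<^sub>R (eH \<curlywedge> eP) + am *\<^sub>R (eC \<curlywedge> eP + eD \<curlywedge> eK) - bm *\<^sub>R (eK \<curlywedge> eM)
                 + (b - 2 * c2) *\<^sub>R (eP \<curlywedge> eM) + (2 * a) *\<^sub>R (eK \<curlywedge> eH))"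
    "\<delta> eK = - (1/2) *\<^sub>R (am *\<^sub>R (eC \<curlywedge> eK) + ap *\<^sub>R (eH \<curlywedge> eK + eD \<curlywedge> eP) - bp *\<^sub>R (eP \<curlywedge> eM)
                 + (b + 2 * c2) *\<^sub>R (eK \<curlywedge> eM) - (2 * a) *\<^sub>R (eP \<curlywedge> eC))"
  by (simp_all add: \<delta>_def vec_eq_iff all_schr_index coboundary_schr_nth schr_bracket_nth
      row_def column_def schr_r_nth wedge_nth axis_nth diff_divide_distrib add_divide_distrib)

text \<open>gl(2) acts without trace on the span of P and K, so \<open>eP \<curlywedge> eK\<close>
  is gl(2)-invariant and has no mixed Schouten terms with the gl(2) part of r. The relations kill
  the gl(2) part, and [K,P] = M leaves the term in \<open>c2\<close>.\<close>

lemma schouten_schr_r: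
  assumes "schr_params ap am bp bm a b"
  shows "schouten schr_bracket (schr_r ap am bp bm a b c2) = - (c2\<^sup>2) *\<^sub>R wedge3 eK eM eP"
proof -
  have rel: "ap * b - bp * a = 0" "ap * bm + am * bp = 0" "am * b + bm * a = 0" "a * a + ap * am = 0"
    using assms by (auto simp: schr_params_def power2_eq_square)
  show ?thesis
    using rel
    by (simp add: vec_eq_iff all_schr_index schouten_nth[OF lie_bracket_schr] schr_bracket_nth
      row_def column_def schr_r_nth wedge3_nth axis_nth power2_eq_square algebra_simps)
qed

text \<open>The rows are needed for arbitrary \<open>X\<close>, since co-Jacobi applies the
  cocommutator to its own rows.\<close>

lemma coboundary_schr_r_nth:
  "coboundary schr_bracket (schr_r ap am bp bm a b c2) X $ i = (case i of
     gD \<Rightarrow> (ap * X$gD - a * X$gH) *\<^sub>R eH - (am * X$gD + a * X$gC) *\<^sub>R eC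
        + (bm/2 * X$gH - bp/2 * X$gC) *\<^sub>R eM + (am/2 * X$gP) *\<^sub>R eK - (ap/2 * X$gK) *\<^sub>R eP
   | gH \<Rightarrow> (a * X$gH - ap * X$gD) *\<^sub>R eD - (am * X$gH + ap * X$gC) *\<^sub>R eC
        + (b * X$gH - bp * X$gD) *\<^sub>R eM + (ap/2 * X$gP) *\<^sub>R eP - (a * X$gP + ap/2 * X$gK) *\<^sub>R eK
   | gP \<Rightarrow> (ap/2 * X$gK) *\<^sub>R eD - (ap/2 * X$gP) *\<^sub>R eH + (a * X$gK - am/2 * X$gP) *\<^sub>R eC
        + ((b/2 - c2) * X$gP + bp/2 * X$gK) *\<^sub>R eM
   | gK \<Rightarrow> - (am/2 * X$gP) *\<^sub>R eD + (a * X$gP + ap/2 * X$gK) *\<^sub>R eH + (am/2 * X$gK) *\<^sub>R eC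
        - (bm/2 * X$gP + (b/2 + c2) * X$gK) *\<^sub>R eM
   | gC \<Rightarrow> (am * X$gD + a * X$gC) *\<^sub>R eD + (am * X$gH + ap * X$gC) *\<^sub>R eH
        + (bm * X$gD - b * X$gC) *\<^sub>R eM - (a * X$gK - am/2 * X$gP) *\<^sub>R eP - (am/2 * X$gK) *\<^sub>R eK
   | gM \<Rightarrow> - (bm/2 * X$gH - bp/2 * X$gC) *\<^sub>R eD - (b * X$gH - bp * X$gD) *\<^sub>R eH
        - (bm * X$gD - b * X$gC) *\<^sub>R eC - ((b/2 - c2) * X$gP + bp/2 * X$gK) *\<^sub>R eP
        + (bm/2 * X$gP + (b/2 + c2) * X$gK) *\<^sub>R eK)"
  by (cases i)
    (simp_all add: vec_eq_iff all_schr_index coboundary_schr_nth schr_bracket_nth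
      row_def column_def schr_r_nth axis_nth field_simps)

text \<open>Conceptually this is ad-invariance of the Schouten bracket, a multiple of
  \<open>wedge3 eK eM eP\<close>. The proof evaluates all 1296 basis entries and reduces them by the
  four relations.\<close>

lemma coJacobi_schr_r:
  fixes ap am bp bm a b c2 :: real
  defines "\<delta> \<equiv> coboundary schr_bracket (schr_r ap am bp bm a b c2)"
  assumes "schr_params ap am bp bm a b"
  shows "\<delta> (row i (\<delta> (axis l 1))) $ j $ k + \<delta> (row j (\<delta> (axis l 1))) $ k $ i
             + \<delta> (row k (\<delta> (axis l 1))) $ i $ j = 0"
proof -
  have rel: "ap * b - bp * a = 0" "ap * bm + am * bp = 0" "am * b + bm * a = 0" "a * a + ap * am = 0"
    using assms by (auto simp: schr_params_def power2_eq_square)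
  show ?thesis
    using rel
    by (cases l; cases i; cases j; cases k;
      simp add: \<delta>_def coboundary_schr_r_nth row_def axis_nth;
      simp add: algebra_simps add_divide_distrib diff_divide_distrib)
qed

lemma transpose_schr_r: "transpose (schr_r ap am bp bm a b c2) = - schr_r ap am bp bm a b c2"
  by (simp add: vec_eq_iff all_schr_index transpose_def schr_r_nth axis_nth)

lemma lie_bialgebra_schr_r:
  assumes "schr_params ap am bp bm a b"
  shows "lie_bialgebra schr_bracket (coboundary schr_bracket (schr_r ap am bp bm a b c2))"
  by (intro lie_bialgebra_coboundaryI lie_bracket_schr transpose_schr_r coJacobi_schr_r assms)

lemma schr_params_of_lie_bialgebra:
  assumes "lie_bialgebra schr_bracket (coboundary schr_bracket (schr_r ap am bp bm a b c2))"
    (is "lie_bialgebra _ ?\<delta>")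
  shows "schr_params ap am bp bm a b"
proof -
  have "linear ?\<delta>"
    by (rule linear_coboundary[OF lie_bracket_schr])
  from lie_bracket_dual_bracket_iff[OF this]
  have "?\<delta> (row i (?\<delta> X)) $ j $ k + ?\<delta> (row j (?\<delta> X)) $ k $ i + ?\<delta> (row k (?\<delta> X)) $ i $ j = 0"
    for X i j k
    using assms unfolding lie_bialgebra_def by blast
  \<comment> \<open>Up to nonzero factors these entries are the first, third, second and fourth
    relation; only the last involves P and K.\<close>
  from this[of gD eD gH gM] this[of gD eD gC gM] this[of gD eH gH gM] this[of gD eP gH gK]
  show ?thesis
    by (simp add: schr_params_def coboundary_schr_r_nth row_def axis_nth power2_eq_square algebra_simps)
qed

section \<open>Restriction to gl(2)\<close>

lemma gl2_r_nth:
  "gl2_r ap am bp bm a b $ i = (case i of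
     hD \<Rightarrow> (1/2) *\<^sub>R (- ap *\<^sub>R axis hH 1 - am *\<^sub>R axis hC 1 + b *\<^sub>R axis hM 1)
   | hH \<Rightarrow> (1/2) *\<^sub>R (ap *\<^sub>R axis hD 1 + bp *\<^sub>R axis hM 1 + (2 * a) *\<^sub>R axis hC 1)
   | hC \<Rightarrow> (1/2) *\<^sub>R (am *\<^sub>R axis hD 1 + bm *\<^sub>R axis hM 1 - (2 * a) *\<^sub>R axis hH 1)
   | hM \<Rightarrow> (1/2) *\<^sub>R (- bp *\<^sub>R axis hH 1 - bm *\<^sub>R axis hC 1 - b *\<^sub>R axis hD 1))"
  by (cases i) (simp_all add: vec_eq_iff all_gl2_index gl2_r_def schr_r_nth axis_nth)

lemma transpose_gl2_r: "transpose (gl2_r ap am bp bm a b) = - gl2_r ap am bp bm a b"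
  by (simp add: vec_eq_iff all_gl2_index transpose_def gl2_r_nth axis_nth)

text \<open>A skew 4 by 4 matrix has six free entries, matched by the six parameters; the factors 2
  undo the 1/2 in \<open>schr_r\<close>.\<close>

lemma skew_gl2_cases:
  fixes r :: "real^gl2_index^gl2_index"
  assumes "transpose r = - r"
  obtains ap am bp bm a b where "r = gl2_r ap am bp bm a b"
proof
  have skew: "r $ j $ i = - r $ i $ j" for i j
    using arg_cong[OF assms, of "\<lambda>t. t $ i $ j"] by (simp add: transpose_def)
  have "r $ i $ i = 0" for i
    using skew[of i i] by simp
  then show "r = gl2_r (-2 * r $ hD $ hH) (-2 * r $ hD $ hC) (2 * r $ hH $ hM) (2 * r $ hC $ hM)
      (r $ hH $ hC) (2 * r $ hD $ hM)"
    using skew[of hD hH] skew[of hD hC] skew[of hD hM] skew[of hH hC] skew[of hH hM] skew[of hC hM]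
    by (simp add: vec_eq_iff all_gl2_index gl2_r_nth axis_nth)
qed

text \<open>The Schouten bracket lies in the third exterior power of a four-dimensional space. Its
  four independent components are, up to nonzero factors, the four relations.\<close>

lemma schouten_gl2_r_eq_0_iff:
  "schouten gl2_bracket (gl2_r ap am bp bm a b) = 0 \<longleftrightarrow> schr_params ap am bp bm a b"
  (is "?s = 0 \<longleftrightarrow> _")
proof
  note entries = schouten_nth[OF lie_bracket_gl2] gl2_bracket_nth row_def column_def gl2_r_nth axis_nth
  {
    assume "?s = 0"
    then have "?s $ x $ y $ z = 0" for x y z
      by simp
    from this[of hD hH hC] this[of hD hH hM] this[of hD hC hM] this[of hH hC hM]
    show "schr_params ap am bp bm a b"
      by (simp add: entries schr_params_def power2_eq_square algebra_simps)
  next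
    assume "schr_params ap am bp bm a b"
    then show "?s = 0"
      by (simp add: vec_eq_iff all_gl2_index entries schr_params_def power2_eq_square algebra_simps)
  }
qed

lemma tensor_map_gl2_incl_nth:
  "tensor_map gl2_incl gl2_incl t $ gl2_emb i $ gl2_emb j = t $ i $ j"
  "k \<in> {gP, gK} \<or> l \<in> {gP, gK} \<Longrightarrow> tensor_map gl2_incl gl2_incl t $ k $ l = 0"
  by (cases i; cases j; simp add: tensor_map_nth gl2_incl_axis UNIV_gl2_index axis_nth)
    (auto simp: tensor_map_nth gl2_incl_axis UNIV_gl2_index axis_nth)

text \<open>By gl(2)-invariance of \<open>eP \<curlywedge> eK\<close> the parameter
  \<open>c2\<close> disappears on the subalgebra, and the other terms of r already live in
  gl(2).\<close>

lemma coboundary_gl2_r: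
  "coboundary schr_bracket (schr_r ap am bp bm a b c2) (gl2_incl X)
    = tensor_map gl2_incl gl2_incl (coboundary gl2_bracket (gl2_r ap am bp bm a b) X)"
  by (simp add: vec_eq_iff all_schr_index coboundary_schr_r_nth tensor_map_nth gl2_incl_axis
      UNIV_gl2_index axis_nth coboundary_gl2_nth gl2_bracket_nth gl2_r_nth row_def column_def
      algebra_simps)

text \<open>Co-Jacobi is inherited from the Schroedinger algebra: on gl(2) the ambient cocommutator
  has no P or K entries, so taking rows commutes with the inclusion.\<close>

lemma lie_bialgebra_gl2_r:
  assumes "schr_params ap am bp bm a b"
  shows "lie_bialgebra gl2_bracket (coboundary gl2_bracket (gl2_r ap am bp bm a b))"
proof (intro lie_bialgebra_coboundaryI lie_bracket_gl2 transpose_gl2_r)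
  let ?\<delta>h = "coboundary gl2_bracket (gl2_r ap am bp bm a b)"
  let ?\<delta> = "coboundary schr_bracket (schr_r ap am bp bm a b 0)"
  have "?\<delta>h X $ i $ j = ?\<delta> (gl2_incl X) $ gl2_emb i $ gl2_emb j" for X i j
    by (simp add: coboundary_gl2_r tensor_map_gl2_incl_nth)
  moreover have "gl2_incl (row i (?\<delta>h X)) = row (gl2_emb i) (?\<delta> (gl2_incl X))" for i X
    by (cases i)
      (simp_all add: vec_eq_iff all_schr_index row_def coboundary_gl2_r tensor_map_nth gl2_incl_axis
        UNIV_gl2_index axis_nth)
  ultimately show "?\<delta>h (row i (?\<delta>h (axis l 1))) $ j $ k + ?\<delta>h (row j (?\<delta>h (axis l 1))) $ k $ i
      + ?\<delta>h (row k (?\<delta>h (axis l 1))) $ i $ j = 0" for i j k l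
    using coJacobi_schr_r[OF assms, of 0 "gl2_emb i" "gl2_emb l" "gl2_emb j" "gl2_emb k"]
    by (simp add: gl2_incl_axis)
qed

lemma lie_sub_bialgebra_gl2_r:
  assumes "schr_params ap am bp bm a b"
  shows "lie_sub_bialgebra gl2_incl gl2_bracket (coboundary gl2_bracket (gl2_r ap am bp bm a b))
    schr_bracket (coboundary schr_bracket (schr_r ap am bp bm a b c2))"
  by (simp add: lie_sub_bialgebra_def lie_bialgebra_gl2_r lie_bialgebra_schr_r assms linear_gl2_incl
      inj_gl2_incl gl2_incl_bracket coboundary_gl2_r)

lemma nonstandard_gl2_iff:
  "nonstandard gl2_bracket \<delta> \<longleftrightarrow>
    (\<exists>ap am bp bm a b. schr_params ap am bp bm a b \<and> \<delta> = coboundary gl2_bracket (gl2_r ap am bp bm a b))"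
  unfolding nonstandard_def
  by (metis skew_gl2_cases schouten_gl2_r_eq_0_iff transpose_gl2_r)

section \<open>Extensions of cocommutators from gl(2)\<close>

text \<open>The linear half of the classification: co-Jacobi is not assumed, and the parameters are
  still unconstrained.\<close>

lemma cocycle_preserving_gl2:
  fixes \<delta> :: "schr \<Rightarrow> real^schr_index^schr_index"
  assumes lin: "linear \<delta>"
    and cocycle: "\<And>X Y. \<delta> (schr_bracket X Y)
      = - ad_tensor schr_bracket Y (\<delta> X) + ad_tensor schr_bracket X (\<delta> Y)"
    and skew: "\<And>X i j. \<delta> X $ i $ j = - \<delta> X $ j $ i"
    and gl2: "\<And>x i j. x \<notin> {gP, gK} \<Longrightarrow> i \<in> {gP, gK} \<or> j \<in> {gP, gK} \<Longrightarrow> \<delta> (axis x 1) $ i $ j = 0"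
  obtains ap am bp bm a b c2 where "\<delta> = coboundary schr_bracket (schr_r ap am bp bm a b c2)"
proof
  have E: "\<delta> (schr_table x y - schr_table y x) $ i $ j
      = - (schr_bracket (axis y 1) (row i (\<delta> (axis x 1))) $ j
           + schr_bracket (axis y 1) (column j (\<delta> (axis x 1))) $ i)
        + (schr_bracket (axis x 1) (row i (\<delta> (axis y 1))) $ j
           + schr_bracket (axis x 1) (column j (\<delta> (axis y 1))) $ i)" for x y i j
    using cocycle[of "axis x 1" "axis y 1"]
    by (simp add: schr_bracket_axis ad_tensor_nth[OF lie_bracket_schr])
  have diag: "\<delta> X $ i $ i = 0" for X i
    using skew[of X i i] by simp
  \<comment> \<open>Every entry is normalized to the index order D, H, P, K, C, M; the general
    skewness law would loop as a rewrite rule.\<close>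
  note flip = skew[of _ gH gD] skew[of _ gP gD] skew[of _ gK gD] skew[of _ gC gD] skew[of _ gM gD]
    skew[of _ gP gH] skew[of _ gK gH] skew[of _ gC gH] skew[of _ gM gH] skew[of _ gK gP]
    skew[of _ gC gP] skew[of _ gM gP] skew[of _ gC gK] skew[of _ gM gK] skew[of _ gM gC]
  note entries = linear_neg[OF lin] linear_scale[OF lin] linear_0[OF lin] schr_bracket_nth
    row_def column_def axis_nth gl2 diag flip
  \<comment> \<open>For \<open>[D, Y] = w Y\<close> the identity gives the components of \<open>\<delta>(Y)\<close> of weight different from \<open>w\<close>
    under \<open>D\<close> in terms of \<open>\<delta>(D)\<close>; the components of weight \<open>w\<close> come from the other pairs.\<close>
  have DC: "\<delta> eC $ gD $ gH = 0"
    "\<delta> eC $ gD $ gM = \<delta> eD $ gH $ gM / 2"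
    "\<delta> eC $ gH $ gC = - \<delta> eD $ gD $ gH"
    "\<delta> eC $ gH $ gM = 0"
    using E[of gD gC gD gH] E[of gD gC gD gM] E[of gD gC gH gC] E[of gD gC gH gM]
    by - (simp (no_asm_use) add: entries; linarith)+
  have DH: "\<delta> eD $ gD $ gM = 0"
    "\<delta> eD $ gH $ gC = 0"
    "\<delta> eH $ gC $ gM = 0"
    "\<delta> eH $ gD $ gC = 0"
    "\<delta> eH $ gD $ gM = \<delta> eD $ gC $ gM / 2"
    "\<delta> eH $ gH $ gC = \<delta> eD $ gD $ gC"
    using E[of gD gH gH gM] E[of gD gH gD gH] E[of gD gH gC gM] E[of gD gH gD gC] E[of gD gH gD gM]
      E[of gD gH gH gC]
    by - (simp (no_asm_use) add: entries; linarith)+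
  have DK: "\<delta> eK $ gC $ gM = 0"
    "\<delta> eK $ gD $ gC = 0"
    "\<delta> eK $ gD $ gH = 0"
    "\<delta> eK $ gD $ gM = 0"
    "\<delta> eK $ gD $ gP = - \<delta> eD $ gD $ gH / 2"
    "\<delta> eK $ gH $ gC = 0"
    "\<delta> eK $ gH $ gK = - \<delta> eD $ gD $ gH / 2"
    "\<delta> eK $ gH $ gM = 0"
    "\<delta> eK $ gH $ gP = 0"
    "\<delta> eK $ gK $ gC = - \<delta> eD $ gD $ gC / 2"
    "\<delta> eK $ gP $ gK = 0"
    "\<delta> eK $ gP $ gM = - \<delta> eD $ gH $ gM / 2"
    using E[of gD gK gC gM] E[of gD gK gD gC] E[of gD gK gD gH] E[of gD gK gD gM] E[of gD gK gD gP]
      E[of gD gK gH gC] E[of gD gK gH gK] E[of gD gK gH gM] E[of gD gK gH gP] E[of gD gK gK gC]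
      E[of gD gK gP gK] E[of gD gK gP gM]
    by - (simp (no_asm_use) add: entries; linarith)+
  \<comment> \<open>This entry has the weight of K, so the pair D, K cannot determine it; [K,H] = P
    does.\<close>
  have HK: "\<delta> eK $ gK $ gM = \<delta> eP $ gP $ gM - \<delta> eH $ gH $ gM"
    using E[of gH gK gP gM] by (simp (no_asm_use) add: entries; linarith)
  have DM: "\<delta> eM $ gC $ gM = 0"
    "\<delta> eM $ gD $ gC = 0"
    "\<delta> eM $ gD $ gH = 0"
    "\<delta> eM $ gH $ gM = 0"
    using E[of gD gM gC gM] E[of gD gM gD gC] E[of gD gM gD gH] E[of gD gM gH gM]
    by - (simp (no_asm_use) add: entries; linarith)+
  have HM: "\<delta> eM $ gD $ gM = 0"
    "\<delta> eM $ gH $ gC = 0"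
    using E[of gH gM gH gM] E[of gH gM gD gH]
    by - (simp (no_asm_use) add: entries; linarith)+
  have DP: "\<delta> eP $ gC $ gM = 0"
    "\<delta> eP $ gD $ gC = 0"
    "\<delta> eP $ gD $ gH = 0"
    "\<delta> eP $ gD $ gK = - \<delta> eD $ gD $ gC / 2"
    "\<delta> eP $ gD $ gM = 0"
    "\<delta> eP $ gH $ gC = 0"
    "\<delta> eP $ gH $ gM = 0"
    "\<delta> eP $ gH $ gP = \<delta> eD $ gD $ gH / 2"
    "\<delta> eP $ gK $ gC = 0"
    "\<delta> eP $ gK $ gM = - \<delta> eD $ gC $ gM / 2"
    "\<delta> eP $ gP $ gC = \<delta> eD $ gD $ gC / 2"
    "\<delta> eP $ gP $ gK = 0"
    using E[of gD gP gC gM] E[of gD gP gD gC] E[of gD gP gD gH] E[of gD gP gD gK] E[of gD gP gD gM]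
      E[of gD gP gH gC] E[of gD gP gH gM] E[of gD gP gH gP] E[of gD gP gK gC] E[of gD gP gK gM]
      E[of gD gP gP gC] E[of gD gP gP gK]
    by - (simp (no_asm_use) add: entries; linarith)+
  \<comment> \<open>The weight 2 entries of \<open>\<delta> eC\<close> follow from [H,C] = D and the
    vanishing of the (D,M) and (H,C) entries of \<open>\<delta> eD\<close>.\<close>
  have CCM: "\<delta> eC $ gC $ gM = - \<delta> eH $ gH $ gM"
    using E[of gD gH gH gM] E[of gH gC gD gM]
    by (simp (no_asm_use) add: entries; linarith)
  have CDC: "\<delta> eC $ gD $ gC = \<delta> eH $ gD $ gH"
    using E[of gD gH gD gH] E[of gH gC gH gC]
    by (simp (no_asm_use) add: entries; linarith)
  \<comment> \<open>These weight-preserving entries are coupled, so their equations are solved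
    jointly; the first two instances supply the relation \<open>CDC\<close> again.\<close>
  have mixed: "\<delta> eK $ gD $ gK = 0"
    "\<delta> eK $ gP $ gC = - \<delta> eH $ gD $ gH"
    "\<delta> eP $ gD $ gP = 0"
    "\<delta> eP $ gH $ gK = \<delta> eH $ gD $ gH"
    using E[of gD gH gD gH] E[of gH gC gH gC] E[of gH gK gH gK] E[of gH gP gH gP] E[of gP gC gP gC]
      E[of gP gK gP gK]
    by - (simp (no_asm_use) add: entries; linarith)+
  note solved = DC DH DK HK DM HM DP CCM CDC mixed
  \<comment> \<open>Seven entries remain free. The parameters are read off from
    \<open>coboundary_schr_r_axis\<close>; for instance the (P,M) entry of
    \<open>\<delta> eP\<close> is b/2 - c2.\<close>
  let ?r = "schr_r (\<delta> eD $ gD $ gH) (- \<delta> eD $ gD $ gC) (- \<delta> eD $ gH $ gM) (\<delta> eD $ gC $ gM)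
    (- \<delta> eH $ gD $ gH) (\<delta> eH $ gH $ gM) (\<delta> eH $ gH $ gM / 2 - \<delta> eP $ gP $ gM)"
  have "\<delta> (axis x 1) $ i = coboundary schr_bracket ?r (axis x 1) $ i" for x i
    by (cases x; cases i)
      (simp_all add: vec_eq_iff all_schr_index coboundary_schr_r_nth axis_nth gl2 diag flip solved)
  then have "\<delta> (axis x 1) = coboundary schr_bracket ?r (axis x 1)" for x
    by (subst vec_eq_iff) (rule allI)
  then have "(\<Sum>i\<in>UNIV. X $ i *\<^sub>R \<delta> (axis i 1))
      = (\<Sum>i\<in>UNIV. X $ i *\<^sub>R coboundary schr_bracket ?r (axis i 1))" for X
    by (intro sum.cong refl arg_cong[where f = "scaleR _"])
  then show "\<delta> = coboundary schr_bracket ?r"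
    by (intro ext, subst linear_expand[OF lin],
      subst linear_expand[OF linear_coboundary[OF lie_bracket_schr]])
qed

text \<open>Values of \<open>tensor_map gl2_incl gl2_incl\<close> have no P or K entries, which
  makes \<open>cocycle_preserving_gl2\<close> applicable. Co-Jacobi then yields the relations, and
  the gl(2) entries recover \<open>\<delta>h\<close>.\<close>

lemma schr_extension_cases:
  assumes "lie_sub_bialgebra gl2_incl gl2_bracket \<delta>h schr_bracket \<delta>"
  obtains ap am bp bm a b c2 where "schr_params ap am bp bm a b"
    and "\<delta> = coboundary schr_bracket (schr_r ap am bp bm a b c2)"
    and "\<delta>h = coboundary gl2_bracket (gl2_r ap am bp bm a b)"
proof -
  have bialg: "lie_bialgebra schr_bracket \<delta>"
    and res: "\<And>X. \<delta> (gl2_incl X) = tensor_map gl2_incl gl2_incl (\<delta>h X)"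
    using assms by (auto simp: lie_sub_bialgebra_def)
  have gl2_range: "x \<in> range gl2_emb" if "x \<notin> {gP, gK}" for x
    using that by (cases x)
      (auto intro: range_eqI[of _ _ hD] range_eqI[of _ _ hH] range_eqI[of _ _ hC] range_eqI[of _ _ hM])
  have *: "\<delta> (axis x 1) $ i $ j = 0"
    if x: "x \<notin> {gP, gK}" and ij: "i \<in> {gP, gK} \<or> j \<in> {gP, gK}" for x i j
  proof -
    obtain y where "x = gl2_emb y"
      using gl2_range[OF x] by blast
    then have "\<delta> (axis x 1) = tensor_map gl2_incl gl2_incl (\<delta>h (axis y 1))"
      using res[of "axis y 1"] by (simp add: gl2_incl_axis)
    then show ?thesis
      using tensor_map_gl2_incl_nth(2)[OF ij] by simp
  qed
  have lin: "linear \<delta>"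
    using bialg by (simp add: lie_bialgebra_def)
  obtain ap am bp bm a b c2 where \<delta>: "\<delta> = coboundary schr_bracket (schr_r ap am bp bm a b c2)"
  proof (rule cocycle_preserving_gl2[OF lin])
    show "\<delta> (schr_bracket X Y)
      = - ad_tensor schr_bracket Y (\<delta> X) + ad_tensor schr_bracket X (\<delta> Y)" for X Y
      using bialg unfolding lie_bialgebra_def by blast
    show "\<delta> X $ i $ j = - \<delta> X $ j $ i" for X i j
      using bialg unfolding lie_bialgebra_def lie_bracket_dual_bracket_iff[OF lin] by blast
  qed (use * in blast)+
  have "\<delta>h X $ i $ j = coboundary gl2_bracket (gl2_r ap am bp bm a b) X $ i $ j" for X i j
    using arg_cong[OF res[of X], of "\<lambda>t. t $ gl2_emb i $ gl2_emb j"]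
    by (simp add: \<delta> coboundary_gl2_r tensor_map_gl2_incl_nth)
  then have "\<delta>h = coboundary gl2_bracket (gl2_r ap am bp bm a b)"
    by (simp add: fun_eq_iff vec_eq_iff)
  with \<delta> show ?thesis
    using bialg schr_params_of_lie_bialgebra that by blast
qed

section \<open>Classification of the extensions and conclusion\<close>

lemma lie_sub_bialgebra_schr_iff:
  "lie_sub_bialgebra gl2_incl gl2_bracket \<delta>h schr_bracket \<delta> \<longleftrightarrow>
    (\<exists>ap am bp bm a b c2. schr_params ap am bp bm a b \<and>
       \<delta> = coboundary schr_bracket (schr_r ap am bp bm a b c2) \<and>
       \<delta>h = coboundary gl2_bracket (gl2_r ap am bp bm a b))"
  (is "?L \<longleftrightarrow> ?R")
proof
  show ?R if ?L
    using that by (rule schr_extension_cases) blast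
  show ?L if ?R
    using that lie_sub_bialgebra_gl2_r by auto
qed

theorem proposition4p2:
  shows
    "(\<forall>\<delta>\<^sub>g\<^sub>l. lie_bialgebra gl2_bracket \<delta>\<^sub>g\<^sub>l \<longrightarrow>
        ((\<exists>\<delta>. lie_sub_bialgebra gl2_incl gl2_bracket \<delta>\<^sub>g\<^sub>l schr_bracket \<delta>)
          \<longleftrightarrow> nonstandard gl2_bracket \<delta>\<^sub>g\<^sub>l))
     \<and>
     (\<forall>\<delta>. (\<exists>\<delta>\<^sub>g\<^sub>l. nonstandard gl2_bracket \<delta>\<^sub>g\<^sub>l \<and>
               lie_sub_bialgebra gl2_incl gl2_bracket \<delta>\<^sub>g\<^sub>l schr_bracket \<delta>)
        \<longleftrightarrow> (\<exists>ap am bp bm a b c2. schr_params ap am bp bm a b \<and>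
               \<delta> = coboundary schr_bracket (schr_r ap am bp bm a b c2)))
     \<and>
     (\<forall>ap am bp bm a b c2. schr_params ap am bp bm a b \<longrightarrow>
        (let r = schr_r ap am bp bm a b c2; \<delta> = coboundary schr_bracket r in
          \<delta> eD = ap *\<^sub>R (eD \<curlywedge> eH) - am *\<^sub>R (eD \<curlywedge> eC) - bp *\<^sub>R (eH \<curlywedge> eM) + bm *\<^sub>R (eC \<curlywedge> eM) \<and>
          \<delta> eH = - a *\<^sub>R (eD \<curlywedge> eH) + (1/2 * bm) *\<^sub>R (eD \<curlywedge> eM) - am *\<^sub>R (eH \<curlywedge> eC)
                 + b *\<^sub>R (eH \<curlywedge> eM) \<and>
          \<delta> eC = - a *\<^sub>R (eD \<curlywedge> eC) - (1/2 * bp) *\<^sub>R (eD \<curlywedge> eM) - ap *\<^sub>R (eH \<curlywedge> eC)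
                 - b *\<^sub>R (eC \<curlywedge> eM) \<and>
          \<delta> eM = 0 \<and>
          \<delta> eP = (1/2) *\<^sub>R (ap *\<^sub>R (eH \<curlywedge> eP) + am *\<^sub>R (eC \<curlywedge> eP + eD \<curlywedge> eK) - bm *\<^sub>R (eK \<curlywedge> eM)
                 + (b - 2 * c2) *\<^sub>R (eP \<curlywedge> eM) + (2 * a) *\<^sub>R (eK \<curlywedge> eH)) \<and>
          \<delta> eK = - (1/2) *\<^sub>R (am *\<^sub>R (eC \<curlywedge> eK) + ap *\<^sub>R (eH \<curlywedge> eK + eD \<curlywedge> eP) - bp *\<^sub>R (eP \<curlywedge> eM)
                 + (b + 2 * c2) *\<^sub>R (eK \<curlywedge> eM) - (2 * a) *\<^sub>R (eP \<curlywedge> eC)) \<and>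
          schouten schr_bracket r = - (c2\<^sup>2) *\<^sub>R wedge3 eK eM eP))"
proof (intro conjI allI impI)
  fix \<delta>\<^sub>g\<^sub>l
  assume "lie_bialgebra gl2_bracket \<delta>\<^sub>g\<^sub>l"
  show "(\<exists>\<delta>. lie_sub_bialgebra gl2_incl gl2_bracket \<delta>\<^sub>g\<^sub>l schr_bracket \<delta>)
      \<longleftrightarrow> nonstandard gl2_bracket \<delta>\<^sub>g\<^sub>l"
    \<comment> \<open>Both sides now ask for the same six constrained parameters; any
      \<open>c2\<close> gives an extension.\<close>
    unfolding nonstandard_gl2_iff lie_sub_bialgebra_schr_iff by blast
next
  fix \<delta>
  show "(\<exists>\<delta>\<^sub>g\<^sub>l. nonstandard gl2_bracket \<delta>\<^sub>g\<^sub>l \<and>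
          lie_sub_bialgebra gl2_incl gl2_bracket \<delta>\<^sub>g\<^sub>l schr_bracket \<delta>)
      \<longleftrightarrow> (\<exists>ap am bp bm a b c2. schr_params ap am bp bm a b \<and>
            \<delta> = coboundary schr_bracket (schr_r ap am bp bm a b c2))"
    unfolding nonstandard_gl2_iff lie_sub_bialgebra_schr_iff by blast
qed (unfold Let_def, intro conjI coboundary_schr_r_axis schouten_schr_r, assumption)

end
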